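(* Assume that $\boldsymbol P\boldsymbol P^\top+\boldsymbol W\boldsymbol W^\top=\boldsymbol I_n$. When $\boldsymbol\beta$ is unknown with flat prior, the predictive distribution, i.e. the distribution of $\boldsymbol y_0$ conditional to $\boldsymbol y$, $\sigma^2$ and $\boldsymbol\theta$, is Normal with mean vector $$\boldsymbol E_0-\boldsymbol S_{\boldsymbol\theta,0,\boldsymbol W}\left(\boldsymbol W^\top\boldsymbol\Sigma_{\boldsymbol\theta}\boldsymbol W\right)^{-1}\boldsymbol W^\top\boldsymbol y$$ and covariance matrix $$\sigma^2\left\{\boldsymbol S_{\boldsymbol\theta,0,0}-\boldsymbol S_{\boldsymbol\theta,0,\boldsymbol W}\left(\boldsymbol W^\top\boldsymbol\Sigma_{\boldsymbol\theta}\boldsymbol W\right)^{-1}\boldsymbol S_{\boldsymbol\theta,0,\boldsymbol W}^\top\right\}.$$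
   Context: Model: $n>p$; given $\boldsymbol\beta\in\mathbb R^p$, $\sigma^2>0$ and the correlation parameter $\boldsymbol\theta$, the vector $\boldsymbol y\in\mathbb R^n$ (observed points) and $\boldsymbol y_0\in\mathbb R^{n_0}$ (unobserved points) are jointly Gaussian with means $\boldsymbol H\boldsymbol\beta$ and $\boldsymbol H_{0,0}\boldsymbol\beta$, covariances $\sigma^2\boldsymbol\Sigma_{\boldsymbol\theta}$ (of $\boldsymbol y$), $\sigma^2\boldsymbol\Sigma_{\boldsymbol\theta,0,0}$ (of $\boldsymbol y_0$), and cross-covariance $\sigma^2\boldsymbol\Sigma_{\boldsymbol\theta,0,\cdot}$ ($n_0\times n$, between $\boldsymbol y_0$ and $\boldsymbol y$), with transpose $\sigma^2\boldsymbol\Sigma_{\boldsymbol\theta,\cdot,0}$. $\boldsymbol H$ ($n\times p$, rank $p$) and $\boldsymbol H_{0,0}$ ($n_0\times p$) contain the values of the $p$ basis functions of the mean at the observed and unobserved points; $\boldsymbol\Sigma_{\boldsymbol\theta}$ is nonsingular. Prior: given $(\sigma^2,\boldsymbol\theta)$, $\boldsymbol\beta$ has the flat (Lebesgue) prior on $\mathbb R^p$. $\boldsymbol P$ ($n\times p$) and $\boldsymbol W$ ($n\times(n-p)$) are full-rank matrices whose columns span the column space of $\boldsymbol H$ and its orthogonal complement, respectively. Notation: $\boldsymbol H_{0,\cdot}=\boldsymbol H_{0,0}(\boldsymbol P^\top\boldsymbol H)^{-1}$, $\boldsymbol H_{\cdot,0}=\boldsymbol H_{0,\cdot}^\top$,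 $\boldsymbol E_0=\boldsymbol H_{0,\cdot}\boldsymbol P^\top\boldsymbol y$, $\boldsymbol S_{\boldsymbol\theta,0,0}=\boldsymbol\Sigma_{\boldsymbol\theta,0,0}+\boldsymbol H_{0,\cdot}\boldsymbol P^\top\boldsymbol\Sigma_{\boldsymbol\theta}\boldsymbol P\boldsymbol H_{\cdot,0}-\boldsymbol H_{0,\cdot}\boldsymbol P^\top\boldsymbol\Sigma_{\boldsymbol\theta,\cdot,0}-\boldsymbol\Sigma_{\boldsymbol\theta,0,\cdot}\boldsymbol P\boldsymbol H_{\cdot,0}$, $\boldsymbol S_{\boldsymbol\theta,0,\boldsymbol W}=(\boldsymbol H_{0,\cdot}\boldsymbol P^\top\boldsymbol\Sigma_{\boldsymbol\theta}-\boldsymbol\Sigma_{\boldsymbol\theta,0,\cdot})\boldsymbol W$ (an $n_0\times(n-p)$ matrix). *)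

theory Defs
  imports "HOL-Probability.Probability"
begin

definition std_normal_vec :: "(real ^ 'k) measure" where
  "std_normal_vec = density lborel (\<lambda>z. \<Prod>i\<in>UNIV. ennreal (std_normal_density (z $ i)))"

text \<open>
  The normal law with mean \<open>mu\<close> and covariance matrix \<open>C\<close>, as the law of \<open>mu + A Z\<close> with \<open>Z\<close> standard
  normal and \<open>C = A A\<^sup>T\<close>.  Singular covariance matrices are admitted; a matrix \<open>C\<close> that is not
  symmetric positive semidefinite is the covariance of no law.
\<close>
definition multivariate_normal ::
    "(real ^ 'k) measure \<Rightarrow> real ^ 'k \<Rightarrow> real ^ 'k ^ 'k \<Rightarrow> bool" where
  "multivariate_normal N mu C \<longleftrightarrow>
     (\<exists>A :: real ^ 'k ^ 'k. C = A ** transpose A \<and>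
        N = distr std_normal_vec borel (\<lambda>z. mu + A *v z))"

definition append_vec :: "real ^ 'n \<Rightarrow> real ^ 'm \<Rightarrow> real ^ ('n + 'm)" where
  "append_vec u v = (\<chi> k. case k of Inl i \<Rightarrow> u $ i | Inr j \<Rightarrow> v $ j)"

definition left_part :: "real ^ ('n::finite + 'm::finite) \<Rightarrow> real ^ 'n" where
  "left_part w = (\<chi> i. w $ Inl i)"

definition right_part :: "real ^ ('n::finite + 'm::finite) \<Rightarrow> real ^ 'm" where
  "right_part w = (\<chi> j. w $ Inr j)"

definition block_matrix ::
    "real ^ 'n ^ 'n \<Rightarrow> real ^ 'm ^ 'n \<Rightarrow> real ^ 'n ^ 'm \<Rightarrow> real ^ 'm ^ 'm
       \<Rightarrow> real ^ ('n + 'm) ^ ('n + 'm)" where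
  "block_matrix A B C D =
     (\<chi> k. case k of Inl i \<Rightarrow> append_vec (A $ i) (B $ i) | Inr j \<Rightarrow> append_vec (C $ j) (D $ j))"

text \<open>
  \<open>Q\<close> is a regular conditional distribution of \<open>Z\<close> given \<open>X\<close> under \<open>M\<close>.  The measure \<open>M\<close> may be
  infinite (improper); the law of \<open>X\<close> has to be sigma-finite, which makes \<open>Q\<close> unique almost
  everywhere.
\<close>
definition conditional_distribution ::
    "'a measure \<Rightarrow> ('a \<Rightarrow> 'b::topological_space) \<Rightarrow> ('a \<Rightarrow> 'c::topological_space)
       \<Rightarrow> ('b \<Rightarrow> 'c measure) \<Rightarrow> bool" where
  "conditional_distribution M X Z Q \<longleftrightarrow>
     X \<in> borel_measurable M \<and> Z \<in> borel_measurable M \<and>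
     sigma_finite_measure (distr M borel X) \<and>
     Q \<in> borel \<rightarrow>\<^sub>M prob_algebra borel \<and>
     (\<forall>A\<in>sets borel. \<forall>B\<in>sets borel.
        emeasure M {\<omega> \<in> space M. X \<omega> \<in> A \<and> Z \<omega> \<in> B} =
          (\<integral>\<^sup>+ x\<in>A. emeasure (Q x) B \<partial>(distr M borel X)))"

text \<open>
  The joint (improper) measure of data whose law given \<open>\<beta>\<close> is \<open>K \<beta>\<close>, when \<open>\<beta>\<close> has the flat prior
  and is integrated out: it maps \<open>A\<close> to \<open>\<integral> K \<beta> A d\<beta>\<close>.
\<close>
definition flat_prior_joint :: "(real ^ 'p \<Rightarrow> 'a measure) \<Rightarrow> 'a measure" where
  "flat_prior_joint K = Giry_Monad.bind lborel K"

definition H_0dot :: "real ^ 'p ^ 'n \<Rightarrow> real ^ 'p ^ 'm \<Rightarrow> real ^ 'p ^ 'n \<Rightarrow> real ^ 'p ^ 'm" where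
  "H_0dot H H00 P = H00 ** matrix_inv (transpose P ** H)"

definition E_0 ::
    "real ^ 'p ^ 'n \<Rightarrow> real ^ 'p ^ 'm \<Rightarrow> real ^ 'p ^ 'n \<Rightarrow> real ^ 'n \<Rightarrow> real ^ 'm" where
  "E_0 H H00 P y = (H_0dot H H00 P ** transpose P) *v y"

text \<open>
  Below, \<open>Sig\<close> is the covariance of \<open>y\<close>, \<open>Sig0\<close> the cross-covariance between \<open>y\<^sub>0\<close> and \<open>y\<close>,
  and \<open>Sig00\<close> the covariance of \<open>y\<^sub>0\<close>, all up to the factor \<open>sigma2\<close>; the cross-covariance
  between \<open>y\<close> and \<open>y\<^sub>0\<close> is \<open>transpose Sig0\<close>.
\<close>
definition S_00 ::
    "real ^ 'p ^ 'n \<Rightarrow> real ^ 'p ^ 'm \<Rightarrow> real ^ 'p ^ 'n \<Rightarrow>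
     real ^ 'n ^ 'n \<Rightarrow> real ^ 'n ^ 'm \<Rightarrow> real ^ 'm ^ 'm \<Rightarrow> real ^ 'm ^ 'm" where
  "S_00 H H00 P Sig Sig0 Sig00 =
     Sig00
     + H_0dot H H00 P ** transpose P ** Sig ** P ** transpose (H_0dot H H00 P)
     - H_0dot H H00 P ** transpose P ** transpose Sig0
     - Sig0 ** P ** transpose (H_0dot H H00 P)"

definition S_0W ::
    "real ^ 'p ^ 'n \<Rightarrow> real ^ 'p ^ 'm \<Rightarrow> real ^ 'p ^ 'n \<Rightarrow> real ^ 'q ^ 'n \<Rightarrow>
     real ^ 'n ^ 'n \<Rightarrow> real ^ 'n ^ 'm \<Rightarrow> real ^ 'q ^ 'm" where
  "S_0W H H00 P W Sig Sig0 =
     (H_0dot H H00 P ** transpose P ** Sig - Sig0) ** W"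

definition pred_mean ::
    "real ^ 'p ^ 'n \<Rightarrow> real ^ 'p ^ 'm \<Rightarrow> real ^ 'p ^ 'n \<Rightarrow> real ^ 'q ^ 'n \<Rightarrow>
     real ^ 'n ^ 'n \<Rightarrow> real ^ 'n ^ 'm \<Rightarrow> real ^ 'n \<Rightarrow> real ^ 'm" where
  "pred_mean H H00 P W Sig Sig0 y =
     E_0 H H00 P y
     - (S_0W H H00 P W Sig Sig0
        ** matrix_inv (transpose W ** Sig ** W) ** transpose W) *v y"

definition pred_cov ::
    "real \<Rightarrow> real ^ 'p ^ 'n \<Rightarrow> real ^ 'p ^ 'm \<Rightarrow> real ^ 'p ^ 'n \<Rightarrow> real ^ 'q ^ 'n \<Rightarrow>
     real ^ 'n ^ 'n \<Rightarrow> real ^ 'n ^ 'm \<Rightarrow> real ^ 'm ^ 'm \<Rightarrow> real ^ 'm ^ 'm" where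
  "pred_cov sigma2 H H00 P W Sig Sig0 Sig00 =
     sigma2 *\<^sub>R
       (S_00 H H00 P Sig Sig0 Sig00
        - S_0W H H00 P W Sig Sig0
          ** matrix_inv (transpose W ** Sig ** W)
          ** transpose (S_0W H H00 P W Sig Sig0))"

end

theory Submission
  imports Defs
begin

text \<open>
  Given \<open>\<beta>\<close>, write the data as \<open>y = H \<beta> + U z\<close>, \<open>y\<^sub>0 = H\<^sub>0\<^sub>0 \<beta> + V z\<close> with \<open>z\<close> standard normal, where
  \<open>[U; V]\<close> is a factor of the joint covariance.  Put \<open>G = (P\<^sup>T H)\<^sup>-\<^sup>1 P\<^sup>T\<close>, a left inverse of \<open>H\<close>.
  Lebesgue measure is translation invariant, so under the flat prior \<open>\<beta>\<close> may be replaced by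
  \<open>\<beta> - G U z\<close>.  This turns the pair into
    \<open>y = H \<beta> + E z\<close>, \<open>y\<^sub>0 = H\<^sub>0\<^sub>0 \<beta> + (V - H\<^sub>0\<^sub>0 G U) z\<close> with \<open>E = U - H G U = W W\<^sup>T U\<close>,
  and now \<open>G y = \<beta>\<close> and \<open>(1 - H G) y = E z\<close>: the coordinates of \<open>y\<close> along the column space of \<open>H\<close> are
  the parameter, and those orthogonal to it are pure noise.

  It remains to regress one Gaussian vector on another.  With
  \<open>B = - S\<^sub>0\<^sub>W (W\<^sup>T \<Sigma> W)\<^sup>-\<^sup>1 W\<^sup>T\<close> the vector \<open>D z = (V - H\<^sub>0\<^sub>0 G U - B E) z\<close> is uncorrelated with \<open>E z\<close>, hence
  independent of it.  So, given \<open>y\<close>, the law of \<open>y\<^sub>0\<close> is that of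
  \<open>H\<^sub>0\<^sub>0 G y + B (1 - H G) y + D z'\<close> with \<open>z'\<close> standard normal.  The identities in
  \<open>flat_prior_kriging_algebra\<close> identify the mean and \<open>D D\<^sup>T\<close> with the stated expressions.

  The Gaussian input is that the law of a linear image of a standard normal vector depends on its
  covariance alone (\<open>distr_std_gaussian_linear_cong\<close>).  This allows one factor \<open>[U; V]\<close> to serve
  for all \<open>\<beta>\<close>, and it turns orthogonality into independence (\<open>std_gaussian_independent\<close>).  It follows
  from the rotation invariance of the standard normal law, because two linear maps with the same
  covariance differ by a rotation of the source.

  That every version of the conditional law is normal for almost all \<open>y\<close> follows from the almost
  sure uniqueness of regular conditional distributions (\<open>conditional_distribution_unique\<close>); here the
  law of \<open>y\<close> is infinite but sigma-finite, since \<open>G y\<close> is distributed as Lebesgue measure.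
\<close>

section \<open>The standard normal law on a Euclidean space\<close>

text \<open>
  The density depends on the norm only, so rotation invariance can be read off.  An arbitrary
  Euclidean space is allowed because products of such spaces are used to form independent copies.
\<close>
definition std_gaussian :: "'a::euclidean_space measure" where
  "std_gaussian = density lborel (\<lambda>z. ennreal (exp (- (norm z)\<^sup>2 / 2) / sqrt (2 * pi) ^ DIM('a)))"

lemma std_gaussian_density_prod:
  fixes z :: "'a::euclidean_space"
  shows "exp (- (norm z)\<^sup>2 / 2) / sqrt (2 * pi) ^ DIM('a) = (\<Prod>b\<in>Basis. std_normal_density (z \<bullet> b))"
proof -
  have "(norm z)\<^sup>2 = (\<Sum>b\<in>Basis. (z \<bullet> b)\<^sup>2)"
    unfolding power2_norm_eq_inner by (subst euclidean_inner) (simp add: power2_eq_square)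
  then have "- (norm z)\<^sup>2 / 2 = (\<Sum>b\<in>Basis. - (z \<bullet> b)\<^sup>2 / 2)"
    by (simp add: sum_negf sum_divide_distrib)
  then have "exp (- (norm z)\<^sup>2 / 2) = (\<Prod>b\<in>Basis. exp (- (z \<bullet> b)\<^sup>2 / 2))"
    by (simp only: exp_sum finite_Basis)
  then show ?thesis
    by (simp add: std_normal_density_def prod_dividef)
qed

lemma sets_std_gaussian [simp, measurable_cong]: "sets std_gaussian = sets borel"
  and space_std_gaussian [simp]: "space std_gaussian = UNIV"
  by (simp_all add: std_gaussian_def)

lemma prob_space_std_gaussian: "prob_space (std_gaussian :: 'a::euclidean_space measure)"
proof
  have one: "(\<integral>\<^sup>+x. ennreal (std_normal_density x) \<partial>lborel) = 1"
    using prob_space.emeasure_space_1[OF prob_space_normal_density[of 1 0]]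
    by (simp add: emeasure_density)
  have "emeasure (std_gaussian :: 'a measure) UNIV
      = (\<integral>\<^sup>+(z::'a). (\<Prod>b\<in>Basis. ennreal (std_normal_density (z \<bullet> b))) \<partial>lborel)"
    unfolding std_gaussian_def std_gaussian_density_prod
    by (subst emeasure_density) (simp_all add: prod_ennreal[OF normal_density_nonneg])
  also have "\<dots> = 1"
    by (subst nn_integral_lborel_prod) (simp_all add: one)
  finally show "emeasure (std_gaussian :: 'a measure) (space std_gaussian) = 1" by simp
qed

lemma std_normal_vec_eq_std_gaussian: "(std_normal_vec :: (real ^ 'k) measure) = std_gaussian"
proof -
  have "(\<Prod>b\<in>(Basis :: (real ^ 'k) set). std_normal_density (z \<bullet> b)) = (\<Prod>i\<in>UNIV. std_normal_density (z $ i))"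
    for z :: "real ^ 'k"
    by (rule prod.reindex_bij_witness[symmetric, where j="\<lambda>i. axis i 1" and i="\<lambda>b. SOME i. b = axis i 1"])
       (auto simp: Basis_vec_def axis_eq_axis inner_axis)
  then show ?thesis
    unfolding std_normal_vec_def std_gaussian_def std_gaussian_density_prod
    by (simp add: prod_ennreal)
qed

lemma std_gaussian_pair:
  "(std_gaussian :: 'a::euclidean_space measure) \<Otimes>\<^sub>M (std_gaussian :: 'b::euclidean_space measure)
    = std_gaussian"
proof -
  interpret b: prob_space "std_gaussian :: 'b measure" by (rule prob_space_std_gaussian)
  have "(std_gaussian :: 'a measure) \<Otimes>\<^sub>M (std_gaussian :: 'b measure)
      = density (lborel \<Otimes>\<^sub>M lborel) (\<lambda>(x, y). ennreal (exp (- (norm (x::'a))\<^sup>2 / 2) / sqrt (2 * pi) ^ DIM('a))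
           * ennreal (exp (- (norm (y::'b))\<^sup>2 / 2) / sqrt (2 * pi) ^ DIM('b)))"
    unfolding std_gaussian_def
    using b.sigma_finite_measure_axioms[unfolded std_gaussian_def]
    by (intro pair_measure_density lborel.sigma_finite_measure_axioms) auto
  also have "\<dots> = std_gaussian"
    unfolding std_gaussian_def lborel_prod
  proof (intro density_cong AE_I2)
    show "(\<lambda>(x, y). ennreal (exp (- (norm (x::'a))\<^sup>2 / 2) / sqrt (2 * pi) ^ DIM('a))
           * ennreal (exp (- (norm (y::'b))\<^sup>2 / 2) / sqrt (2 * pi) ^ DIM('b))) \<in> borel_measurable lborel"
      unfolding measurable_lborel2 borel_prod[symmetric] by measurable
  qed (auto simp: norm_Pair power_add exp_add[symmetric] add_divide_distrib simp flip: ennreal_mult)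
  finally show ?thesis .
qed

lemma borel_measurable_linear:
  fixes f :: "'a::euclidean_space \<Rightarrow> 'b::euclidean_space"
  shows "linear f \<Longrightarrow> f \<in> borel_measurable borel"
  by (intro borel_measurable_continuous_onI linear_continuous_on) (simp add: linear_conv_bounded_linear)

lemma nn_integral_lborel_translate:
  fixes h :: "'a::euclidean_space \<Rightarrow> ennreal"
  assumes [measurable]: "h \<in> borel_measurable borel"
  shows "(\<integral>\<^sup>+x. h (c + x) \<partial>lborel) = (\<integral>\<^sup>+x. h x \<partial>lborel)"
  by (subst lborel_distr_plus[of c, symmetric]) (simp add: nn_integral_distr)

text \<open>
  The image \<open>\<nu>\<close> of Lebesgue measure \<open>\<lambda>\<close> is again translation invariant, and it gives the unit ball \<open>B\<close>
  the same mass.  By Fubini and translation invariance of both measures,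
  \<open>\<nu> A \<cdot> \<lambda> B = \<integral>\<integral> 1\<^sub>A(x) 1\<^sub>B(y - x) d\<lambda>(y) d\<nu>(x) = \<integral>\<integral> 1\<^sub>A(x + y) 1\<^sub>B(- x) d\<nu>(x) d\<lambda>(y) = \<lambda> A \<cdot> \<nu> B\<close>,
  which is the uniqueness argument for Haar measure.
\<close>
lemma distr_lborel_orthogonal:
  fixes f :: "'a::euclidean_space \<Rightarrow> 'a"
  assumes f: "orthogonal_transformation f"
  shows "distr lborel borel f = lborel"
proof (rule measure_eqI)
  let ?\<nu> = "distr lborel borel f"
  let ?B = "ball 0 1 :: 'a set"
  have [measurable]: "f \<in> borel \<rightarrow>\<^sub>M borel"
    using f by (intro borel_measurable_linear orthogonal_transformation_linear)
  obtain g where g: "orthogonal_transformation g" "\<And>x. f (g x) = x"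
    using orthogonal_transformation_inv[OF f] orthogonal_transformation_surj[OF f]
    by (metis surj_f_inv_f)
  interpret \<nu>: sigma_finite_measure ?\<nu>
  proof -
    have "(\<lambda>x. g x) \<in> borel \<rightarrow>\<^sub>M borel"
      using g(1) by (intro borel_measurable_linear orthogonal_transformation_linear)
    moreover have "g (f x) = x" for x
      using g(2) orthogonal_transformation_inj[OF f] by (metis injD)
    ultimately have "distr ?\<nu> lborel g = lborel"
      by (subst distr_distr) (auto simp: o_def distr_id2)
    then show "sigma_finite_measure ?\<nu>"
      by (intro sigma_finite_measure_distr[where f=g and M="?\<nu>" and N=lborel])
        (use \<open>g \<in> _\<close> in \<open>auto intro: lborel.sigma_finite_measure_axioms\<close>)
  qed
  interpret pair_sigma_finite ?\<nu> lborel ..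
  have shift: "(\<integral>\<^sup>+x. h (x + y) \<partial>?\<nu>) = (\<integral>\<^sup>+x. h x \<partial>?\<nu>)" if [measurable]: "h \<in> borel_measurable borel"
    for h :: "'a \<Rightarrow> ennreal" and y
  proof -
    have "(\<integral>\<^sup>+x. h (x + y) \<partial>?\<nu>) = (\<integral>\<^sup>+x. h (f (g y + x)) \<partial>lborel)"
      using orthogonal_transformation_linear[OF f]
      by (simp add: nn_integral_distr linear_add g add.commute)
    also have "\<dots> = (\<integral>\<^sup>+x. h (f x) \<partial>distr lborel borel ((+) (g y)))"
      by (subst nn_integral_distr) auto
    also have "\<dots> = (\<integral>\<^sup>+x. h x \<partial>?\<nu>)"
      by (simp add: lborel_distr_plus nn_integral_distr)
    finally show ?thesis .
  qed
  have [measurable]: "?B \<in> sets borel" by simp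
  have ball: "emeasure ?\<nu> ?B = emeasure lborel ?B"
  proof -
    have "f -` ?B = ?B"
      using f by (auto simp: orthogonal_transformation)
    then show ?thesis by (simp add: emeasure_distr)
  qed
  fix A assume "A \<in> sets ?\<nu>"
  then have [measurable]: "A \<in> sets borel" by simp
  have "emeasure ?\<nu> A * emeasure lborel ?B
      = (\<integral>\<^sup>+x. indicator A x * (\<integral>\<^sup>+y. indicator ?B (- x + y) \<partial>lborel) \<partial>?\<nu>)"
    by (subst nn_integral_lborel_translate[OF borel_measurable_indicator]) (auto simp: nn_integral_multc)
  also have "\<dots> = (\<integral>\<^sup>+x. (\<integral>\<^sup>+y. indicator A x * indicator ?B (- x + y) \<partial>lborel) \<partial>?\<nu>)"
    by (intro nn_integral_cong nn_integral_cmult[symmetric]) auto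
  also have "\<dots> = (\<integral>\<^sup>+y. (\<integral>\<^sup>+x. indicator A x * indicator ?B (- x + y) \<partial>?\<nu>) \<partial>lborel)"
    by (subst Fubini') auto
  also have "\<dots> = (\<integral>\<^sup>+y. (\<integral>\<^sup>+x. indicator A (x + y) * indicator ?B (- (x + y) + y) \<partial>?\<nu>) \<partial>lborel)"
    by (intro nn_integral_cong shift[symmetric, where h="\<lambda>x. indicator A x * indicator ?B (- x + y)" for y]) auto
  also have "\<dots> = (\<integral>\<^sup>+y. (\<integral>\<^sup>+x. indicator A (x + y) * indicator ?B x \<partial>?\<nu>) \<partial>lborel)"
    by (auto simp: indicator_def)
  also have "\<dots> = (\<integral>\<^sup>+x. (\<integral>\<^sup>+y. indicator A (x + y) * indicator ?B x \<partial>lborel) \<partial>?\<nu>)"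
    by (subst Fubini') auto
  also have "\<dots> = (\<integral>\<^sup>+x. emeasure lborel A * indicator ?B x \<partial>?\<nu>)"
    by (simp add: nn_integral_multc nn_integral_lborel_translate)
  also have "\<dots> = emeasure lborel A * emeasure lborel ?B"
    by (simp add: nn_integral_cmult ball)
  finally show "emeasure ?\<nu> A = emeasure lborel A"
    using emeasure_lborel_ball_finite[of "0::'a" 1] content_ball_pos[of 1 "0::'a"]
    by (auto simp: mult.commute[of _ "emeasure lborel ?B"] ennreal_mult_cancel_left measure_def)
qed simp

lemma distr_std_gaussian_orthogonal:
  fixes f :: "'a::euclidean_space \<Rightarrow> 'a"
  assumes f: "orthogonal_transformation f"
  shows "distr std_gaussian borel f = std_gaussian"
proof -
  have [measurable]: "f \<in> borel_measurable borel"
    using f by (intro borel_measurable_linear orthogonal_transformation_linear)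
  let ?d = "\<lambda>z::'a. ennreal (exp (- (norm z)\<^sup>2 / 2) / sqrt (2 * pi) ^ DIM('a))"
  have "std_gaussian = density (distr lborel borel f) ?d"
    by (simp add: distr_lborel_orthogonal[OF f] std_gaussian_def)
  also have "\<dots> = distr (density lborel (\<lambda>z. ?d (f z))) borel f"
    by (rule density_distr) auto
  also have "\<dots> = distr std_gaussian borel f"
    using f by (simp add: std_gaussian_def orthogonal_transformation)
  finally show ?thesis by simp
qed

lemma distr_std_gaussian_fst:
  fixes f :: "'a::euclidean_space \<Rightarrow> 'c::euclidean_space"
  assumes [measurable]: "f \<in> borel_measurable borel"
  shows "distr (std_gaussian :: ('a \<times> 'b::euclidean_space) measure) borel (\<lambda>z. f (fst z)) = distr std_gaussian borel f"
proof -
  interpret prob_space "std_gaussian :: 'b measure" by (rule prob_space_std_gaussian)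
  have "distr (std_gaussian :: ('a \<times> 'b) measure) borel (\<lambda>z. f (fst z))
      = distr (distr ((std_gaussian :: 'a measure) \<Otimes>\<^sub>M (std_gaussian :: 'b measure)) std_gaussian fst) borel f"
    unfolding std_gaussian_pair[symmetric] by (subst distr_distr) (auto simp: o_def)
  then show ?thesis by (simp add: distr_pair_fst)
qed

lemma distr_std_gaussian_snd:
  fixes f :: "'b::euclidean_space \<Rightarrow> 'c::euclidean_space"
  assumes [measurable]: "f \<in> borel_measurable borel"
  shows "distr (std_gaussian :: ('a::euclidean_space \<times> 'b) measure) borel (\<lambda>z. f (snd z)) = distr std_gaussian borel f"
proof -
  interpret a: prob_space "std_gaussian :: 'a measure" by (rule prob_space_std_gaussian)
  interpret b: prob_space "std_gaussian :: 'b measure" by (rule prob_space_std_gaussian)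
  interpret pair_sigma_finite "std_gaussian :: 'a measure" "std_gaussian :: 'b measure" ..
  have "distr (std_gaussian :: ('a \<times> 'b) measure) borel (\<lambda>z. f (snd z))
     = distr (std_gaussian :: ('b \<times> 'a) measure) borel (\<lambda>z. f (fst z))"
    unfolding std_gaussian_pair[symmetric]
    by (subst distr_pair_swap, subst distr_distr) (auto simp: o_def split_beta')
  then show ?thesis by (simp add: distr_std_gaussian_fst[where f=f and 'b='a])
qed

section \<open>The law of a linear image depends on its covariance only\<close>

text \<open>
  The assignment \<open>p x \<mapsto> q x\<close> is a well-defined linear isometry between the ranges.  Their orthogonal
  complements have equal dimension, so an isometry between these exists, and the two
  isometries are glued along the orthogonal projection.
\<close>
lemma linear_isometry_extend:
  fixes p q :: "'c::euclidean_space \<Rightarrow> 'a::euclidean_space"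
  assumes lin: "linear p" "linear q" and norm: "\<And>x. norm (p x) = norm (q x)"
  obtains f where "orthogonal_transformation f" "\<And>x. f (p x) = q x"
proof -
  obtain r where r: "linear r" "\<And>v. v \<in> range p \<Longrightarrow> p (r v) = v"
    using linear_exists_right_inverse_on[OF lin(1) subspace_UNIV] by auto
  define h where "h = q \<circ> r"
  have h: "linear h" unfolding h_def by (intro linear_compose r lin)
  have hp: "h (p x) = q x" for x
  proof -
    have "p (r (p x) - x) = 0" by (simp add: linear_diff lin r)
    then have "q (r (p x) - x) = 0" by (metis norm norm_eq_zero)
    then show ?thesis by (simp add: h_def linear_diff lin)
  qed
  define V V' where "V = range p" and "V' = range q"
  have V: "subspace V" "subspace V'"
    unfolding V_def V'_def by (intro linear_subspace_image lin subspace_UNIV)+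
  have hV: "h ` V = V'" unfolding V_def V'_def by (force simp: hp)
  have hn: "norm (h v) = norm v" if "v \<in> V" for v
    using that hp norm by (auto simp: V_def)
  have "inj_on h V"
  proof (rule inj_onI)
    fix v w assume "v \<in> V" "w \<in> V" "h v = h w"
    then have "norm (v - w) = norm (h (v - w))" using hn V(1) subspace_diff by metis
    then show "v = w" using \<open>h v = h w\<close> by (simp add: linear_diff h)
  qed
  moreover have "span V = V" using V(1) by simp
  ultimately have dim: "dim V' = dim V"
    unfolding hV[symmetric] by (intro dim_image_eq h) (simp only:)
  define C C' where "C = {y. \<forall>x\<in>V. orthogonal x y}" and "C' = {y. \<forall>x\<in>V'. orthogonal x y}"
  have "dim C + dim V = DIM('a)" "dim C' + dim V' = DIM('a)"
    using dim_subspace_orthogonal_to_vectors[OF V(1) subspace_UNIV]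
      dim_subspace_orthogonal_to_vectors[OF V(2) subspace_UNIV] by (simp_all add: C_def C'_def)
  then have dimC: "dim C = dim C'" using dim by simp
  have "subspace C" "subspace C'"
    unfolding C_def C'_def
    using subspace_orthogonal_to_vectors by blast+
  then obtain k where k: "linear k" "k ` C = C'" "\<And>x. x \<in> C \<Longrightarrow> norm (k x) = norm x"
    by (rule isometries_subspaces[OF _ _ dimC]) blast+
  obtain B where B: "B \<subseteq> V" "pairwise orthogonal B" "span B = V"
    by (rule orthogonal_basis_subspace[OF V(1)])
  \<comment> \<open>the orthogonal projection onto \<open>V\<close>, written in an orthogonal basis so that it is visibly linear\<close>
  define \<pi> where "\<pi> = (\<lambda>a. \<Sum>b\<in>B. (b \<bullet> a / (b \<bullet> b)) *\<^sub>R b)"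
  have \<pi>: "linear \<pi>"
    unfolding \<pi>_def by (intro linearI) (auto simp: inner_add_right add_divide_distrib scaleR_left_distrib
       sum.distrib scaleR_sum_right)
  have \<pi>V: "\<pi> a \<in> V" for a
    unfolding \<pi>_def using V(1) B(1) by (intro subspace_sum subspace_scale) auto
  have \<pi>C: "a - \<pi> a \<in> C" for a
    unfolding C_def \<pi>_def using Gram_Schmidt_step[OF B(2)] B(3) by auto
  have \<pi>p: "\<pi> v = v" if "v \<in> V" for v
  proof -
    have "v - \<pi> v \<in> V" using that \<pi>V V(1) subspace_diff by blast
    then have "orthogonal (v - \<pi> v) (v - \<pi> v)" using \<pi>C[of v] by (auto simp: C_def)
    then show ?thesis by (simp add: orthogonal_def)
  qed
  define f where "f = (\<lambda>a. h (\<pi> a) + k (a - \<pi> a))"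
  have "linear f"
    unfolding f_def
    by (intro linear_compose_add linear_compose[OF \<pi> h, unfolded o_def]
          linear_compose[OF linear_compose_sub[OF linear_ident \<pi>] k(1), unfolded o_def])
  moreover have "norm (f a) = norm a" for a
  proof -
    have "orthogonal (h (\<pi> a)) (k (a - \<pi> a))"
      using \<pi>V[of a] \<pi>C[of a] hV k(2) by (force simp: C'_def)
    then have "(norm (f a))\<^sup>2 = (norm (h (\<pi> a)))\<^sup>2 + (norm (k (a - \<pi> a)))\<^sup>2"
      unfolding f_def by (rule norm_add_Pythagorean)
    also have "\<dots> = (norm (\<pi> a))\<^sup>2 + (norm (a - \<pi> a))\<^sup>2"
      using \<pi>V \<pi>C by (simp add: hn k)
    also have "\<dots> = (norm (\<pi> a + (a - \<pi> a)))\<^sup>2"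
      by (rule norm_add_Pythagorean[symmetric]) (use \<pi>V[of a] \<pi>C[of a] in \<open>auto simp: C_def\<close>)
    finally show ?thesis by simp
  qed
  moreover have "f (p x) = q x" for x
    using \<pi>p[of "p x"] k(1) by (simp add: f_def V_def hp linear_0)
  ultimately show thesis
    using that by (auto simp: orthogonal_transformation)
qed

text \<open>
  The hypothesis says that the covariances \<open>f f\<^sup>*\<close> and \<open>g g\<^sup>*\<close> define the same quadratic form.  The
  sources of \<open>f\<close> and \<open>g\<close> may have different dimensions, so both maps are extended to the product space;
  there a rotation \<open>h\<close> carries \<open>(f\<^sup>* x, 0)\<close> to \<open>(0, g\<^sup>* x)\<close>, that is, \<open>f \<circ> fst = g \<circ> snd \<circ> h\<close>.
\<close>
proposition distr_std_gaussian_linear_cong: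
  fixes f :: "'a::euclidean_space \<Rightarrow> 'c::euclidean_space" and g :: "'b::euclidean_space \<Rightarrow> 'c"
  assumes lin: "linear f" "linear g"
    and norm: "\<And>x. norm (adjoint f x) = norm (adjoint g x)"
  shows "distr std_gaussian borel f = distr std_gaussian borel g"
proof -
  define p where "p = (\<lambda>x. (adjoint f x, 0 :: 'b))"
  define q where "q = (\<lambda>x. (0 :: 'a, adjoint g x))"
  have "linear p" "linear q"
    unfolding p_def q_def using adjoint_linear[OF lin(1)] adjoint_linear[OF lin(2)]
    by (auto intro!: linearI simp: linear_add linear_scale)
  moreover have "norm (p x) = norm (q x)" for x by (simp add: p_def q_def norm_Pair norm)
  ultimately obtain h where h: "orthogonal_transformation h" "\<And>x. h (p x) = q x"
    using linear_isometry_extend by blast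
  have [measurable]: "f \<in> borel_measurable borel" "g \<in> borel_measurable borel" "h \<in> borel_measurable borel"
    using lin h(1) by (auto intro: borel_measurable_linear orthogonal_transformation_linear)
  have [measurable]: "(\<lambda>z::'a \<times> 'b. g (snd z)) \<in> borel_measurable borel"
    by (intro borel_measurable_linear linear_compose[OF linear_snd lin(2), unfolded o_def])
  have "g (snd (h z)) = f (fst z)" for z
  proof (rule vector_eq_rdot[THEN iffD1], rule allI)
    fix x
    have "g (snd (h z)) \<bullet> x = h z \<bullet> q x"
      by (simp add: q_def inner_prod_def adjoint_clauses lin)
    also have "\<dots> = z \<bullet> p x"
      using h by (metis orthogonal_transformation_def)
    also have "\<dots> = f (fst z) \<bullet> x"
      by (simp add: p_def inner_prod_def adjoint_clauses lin)
    finally show "g (snd (h z)) \<bullet> x = f (fst z) \<bullet> x" .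
  qed
  then have eq: "(\<lambda>z. g (snd (h z))) = (\<lambda>z. f (fst z))" by (rule ext)
  have "distr std_gaussian borel f = distr (std_gaussian :: ('a \<times> 'b) measure) borel (\<lambda>z. g (snd (h z)))"
    unfolding eq by (rule distr_std_gaussian_fst[symmetric]) fact
  also have "\<dots> = distr (distr std_gaussian borel h) borel (\<lambda>z. g (snd z))"
    by (rule distr_distr[symmetric, unfolded o_def]) measurable
  also have "\<dots> = distr (std_gaussian :: ('a \<times> 'b) measure) borel (\<lambda>z. g (snd z))"
    by (simp only: distr_std_gaussian_orthogonal[OF h(1)])
  also have "\<dots> = distr std_gaussian borel g"
    by (rule distr_std_gaussian_snd) fact
  finally show ?thesis .
qed

text \<open>
  The definition of a multivariate normal law asks for a square factor of the covariance, whereas the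
  covariance of the prediction arises with a rectangular one.  The range of \<open>f\<^sup>*\<close> has dimension at
  most that of the target, so it can be moved isometrically into the target.
\<close>
lemma linear_square_factor:
  fixes f :: "'a::euclidean_space \<Rightarrow> 'c::euclidean_space"
  assumes f: "linear f"
  obtains g :: "'c \<Rightarrow> 'c" where "linear g" "\<And>x. norm (adjoint g x) = norm (adjoint f x)"
proof -
  have af: "linear (adjoint f)" by (rule adjoint_linear[OF f])
  have "subspace (range (adjoint f))" by (intro linear_subspace_image af subspace_UNIV)
  moreover have "dim (range (adjoint f)) \<le> dim (UNIV :: 'c set)"
    by (rule dim_image_le[OF af])
  ultimately obtain j :: "'a \<Rightarrow> 'c" where j: "linear j" "\<And>v. v \<in> range (adjoint f) \<Longrightarrow> norm (j v) = norm v"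
    using isometry_subset_subspace[OF _ subspace_UNIV] by metis
  have l: "linear (j \<circ> adjoint f)" by (intro linear_compose af j)
  show thesis
    by (rule that[of "adjoint (j \<circ> adjoint f)"])
      (use j in \<open>auto simp: adjoint_linear adjoint_adjoint l\<close>)
qed

text \<open>
  Uncorrelated jointly Gaussian vectors are independent: by Pythagoras both sides have the same
  covariance.
\<close>
lemma std_gaussian_independent:
  fixes f :: "'a::euclidean_space \<Rightarrow> 'b::euclidean_space" and g :: "'a \<Rightarrow> 'c::euclidean_space"
  assumes lin: "linear f" "linear g"
    and orth: "\<And>x y. adjoint f x \<bullet> adjoint g y = 0"
  shows "distr std_gaussian borel (\<lambda>z. (f z, g z))
       = distr (std_gaussian \<Otimes>\<^sub>M std_gaussian) borel (\<lambda>(z, z'). (f z, g z'))"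
  unfolding std_gaussian_pair
proof (rule distr_std_gaussian_linear_cong)
  show l1: "linear (\<lambda>z. (f z, g z))" and l2: "linear (\<lambda>(z, z'). (f z, g z'))"
    using lin by (auto intro!: linearI simp: linear_add linear_scale)
  have a1: "adjoint (\<lambda>z. (f z, g z)) = (\<lambda>(x, y). adjoint f x + adjoint g y)"
    by (rule adjoint_unique) (auto simp: inner_prod_def inner_add_right adjoint_works lin)
  have a2: "adjoint (\<lambda>(z, z'). (f z, g z')) = (\<lambda>(x, y). (adjoint f x, adjoint g y))"
    by (rule adjoint_unique) (auto simp: inner_prod_def adjoint_works lin)
  show "norm (adjoint (\<lambda>z. (f z, g z)) v) = norm (adjoint (\<lambda>(z, z'). (f z, g z')) v)" for v
    unfolding a1 a2
    by (cases v) (auto simp: norm_Pair norm_add_Pythagorean orth orthogonal_def real_sqrt_unique[symmetric])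
qed

section \<open>Matrix calculus and multivariate normal laws\<close>

text \<open>Polarization.\<close>
lemma inner_adjoint_eq:
  fixes f :: "'a::euclidean_space \<Rightarrow> 'c::euclidean_space" and g :: "'b::euclidean_space \<Rightarrow> 'c"
  assumes lin: "linear f" "linear g"
    and norm: "\<And>x. norm (adjoint f x) = norm (adjoint g x)"
  shows "adjoint f x \<bullet> adjoint f y = adjoint g x \<bullet> adjoint g y"
  using norm[of x] norm[of y] norm[of "x + y"] lin
  by (simp add: dot_norm adjoint_linear linear_add)

lemma borel_measurable_matrix_vector_mult [measurable (raw)]:
  fixes A :: "real ^ 'k ^ 'm"
  shows "f \<in> borel_measurable M \<Longrightarrow> (\<lambda>x. A *v f x) \<in> borel_measurable M"
  using measurable_compose[OF _ borel_measurable_linear[OF matrix_vector_mul_linear[of A]]] .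

lemma inner_transpose_mult:
  fixes A :: "real ^ 'k ^ 'm" and B :: "real ^ 'k ^ 'j"
  shows "(transpose A *v x) \<bullet> (transpose B *v y) = x \<bullet> ((A ** transpose B) *v y)"
  by (simp add: transpose_matrix_vector dot_lmul_matrix matrix_vector_mul_assoc[symmetric])

lemma matrix_add_rdistrib: "(A + B) ** C = A ** C + B ** C"
  for A :: "real ^ 'n ^ 'm"
  by (simp add: matrix_matrix_mult_def vec_eq_iff distrib_right sum.distrib)

lemma matrix_diff_ldistrib: "A ** (B - C) = A ** B - A ** C"
  for A :: "real ^ 'n ^ 'm"
  by (simp add: matrix_matrix_mult_def vec_eq_iff right_diff_distrib sum_subtractf)

lemma matrix_diff_rdistrib: "(A - B) ** C = A ** C - B ** C"
  for A :: "real ^ 'n ^ 'm"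
  by (simp add: matrix_matrix_mult_def vec_eq_iff left_diff_distrib sum_subtractf)

lemma matrix_mult_zero: "A ** 0 = 0" "0 ** A = 0"
  for A :: "real ^ 'n ^ 'm"
  by (simp_all add: matrix_matrix_mult_def vec_eq_iff)

lemma matrix_mult_minus: "A ** (- B) = - (A ** B)" "(- A) ** B = - (A ** B)"
  for A :: "real ^ 'n ^ 'm"
  by (simp_all add: matrix_matrix_mult_def vec_eq_iff sum_negf)

lemma matrix_mult_scaleR: "A ** (c *\<^sub>R B) = c *\<^sub>R (A ** B)" "(c *\<^sub>R A) ** B = c *\<^sub>R (A ** B)"
  for A :: "real ^ 'n ^ 'm"
  by (simp_all add: matrix_matrix_mult_def vec_eq_iff sum_distrib_left mult_ac)

lemma transpose_linear:
  fixes A B :: "real ^ 'n ^ 'm"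
  shows "transpose (A - B) = transpose A - transpose B" "transpose (c *\<^sub>R A) = c *\<^sub>R transpose A"
    "transpose (0 :: real ^ 'n ^ 'm) = 0" "transpose (- A) = - transpose A"
  by (simp_all add: transpose_def vec_eq_iff)

lemma matrix_inv_inverse:
  fixes A :: "real ^ 'n ^ 'n"
  assumes "invertible A"
  shows "A ** matrix_inv A = mat 1" "matrix_inv A ** A = mat 1"
  using someI_ex[OF assms[unfolded invertible_def]] by (auto simp: matrix_inv_def)

text \<open>
  A multivariate normal law is given by any factor of its covariance, square or not.  In the model this
  gives a single factor for all values of the regression coefficients.
\<close>
lemma multivariate_normal_unique:
  fixes A :: "real ^ 'k ^ 'm"
  assumes "multivariate_normal N mu (A ** transpose A)"
  shows "N = distr std_normal_vec borel (\<lambda>z. mu + A *v z)"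
proof -
  obtain B :: "real ^ 'm ^ 'm" where B: "A ** transpose A = B ** transpose B"
    "N = distr std_normal_vec borel (\<lambda>z. mu + B *v z)"
    using assms unfolding multivariate_normal_def by blast
  have shift: "distr std_gaussian borel (\<lambda>z. mu + C *v z) = distr (distr std_gaussian borel ((*v) C)) borel ((+) mu)"
    for C :: "real ^ 'j ^ 'm"
    by (subst distr_distr) (auto simp: o_def)
  have "distr std_gaussian borel ((*v) B) = distr std_gaussian borel ((*v) A)"
    by (rule distr_std_gaussian_linear_cong) (simp_all only: adjoint_matrix norm_eq_sqrt_inner inner_transpose_mult B matrix_vector_mul_linear)
  then show ?thesis
    unfolding B(2) std_normal_vec_eq_std_gaussian shift by simp
qed

lemma multivariate_normal_distr:
  fixes A :: "real ^ 'k ^ 'm"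
  shows "multivariate_normal (distr std_normal_vec borel (\<lambda>z. mu + A *v z)) mu (A ** transpose A)"
proof -
  obtain g :: "real ^ 'm \<Rightarrow> real ^ 'm"
    where g: "linear g" "\<And>x. norm (adjoint g x) = norm (adjoint ((*v) A) x)"
    using linear_square_factor[of "(*v) A"] by auto
  define B where "B = matrix g"
  have gB: "g = (*v) B" using g(1) by (auto simp: B_def)
  have "(transpose B *v x) \<bullet> (transpose B *v y) = (transpose A *v x) \<bullet> (transpose A *v y)" for x y
    using inner_adjoint_eq[OF g(1) _ g(2)] by (simp add: gB adjoint_matrix)
  then have "x \<bullet> ((B ** transpose B) *v y) = x \<bullet> ((A ** transpose A) *v y)" for x y
    by (simp only: inner_transpose_mult)
  then have "B ** transpose B = A ** transpose A"
    by (metis matrix_eq vector_eq_ldot)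
  moreover have "multivariate_normal (distr std_normal_vec borel (\<lambda>z. mu + B *v z)) mu (B ** transpose B)"
    unfolding multivariate_normal_def by blast
  ultimately show ?thesis
    using multivariate_normal_unique by metis
qed

section \<open>Uniqueness of conditional distributions\<close>

text \<open>
  Equality of two kernels on each set of a countable generator holds outside one common null
  set; stability under intersection then gives equality of the measures.
\<close>
lemma countable_Int_stable_generator_borel:
  obtains E :: "'a::second_countable_topology set set"
  where "countable E" "Int_stable E" "UNIV \<in> E" "sets borel = sigma_sets UNIV E"
proof -
  obtain B :: "'a set set" where B: "countable B" "topological_basis B"
    using ex_countable_basis by blast
  define E where "E = (\<lambda>F. \<Inter>F) ` {F. finite F \<and> F \<subseteq> B}"
  have gen: "sets borel = sigma_sets UNIV B"
    by (subst borel_eq_countable_basis[OF B]) (rule sets_measure_of, simp)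
  have "Int_stable E"
    unfolding Int_stable_def E_def
  proof clarify
    fix F G assume "finite F" "F \<subseteq> B" "finite G" "G \<subseteq> B"
    then show "\<Inter>F \<inter> \<Inter>G \<in> (\<lambda>F. \<Inter>F) ` {F. finite F \<and> F \<subseteq> B}"
      by (intro image_eqI[of _ _ "F \<union> G"]) auto
  qed
  moreover have "countable E"
    unfolding E_def using countable_Collect_finite_subset[OF B(1)] by simp
  moreover have "UNIV \<in> E" unfolding E_def by (intro image_eqI[of _ _ "{}"]) auto
  moreover have "sets borel = sigma_sets UNIV E"
  proof (intro equalityI)
    have "B \<subseteq> E" unfolding E_def by (auto intro!: image_eqI[of _ _ "{_}"])
    then show "sets borel \<subseteq> sigma_sets UNIV E"
      unfolding gen by (rule sigma_sets_mono')
    have "E \<subseteq> sets borel"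
    proof
      fix X assume "X \<in> E"
      then obtain F where F: "finite F" "F \<subseteq> B" "X = \<Inter>F" by (auto simp: E_def)
      then have "\<forall>S\<in>F. open S" using topological_basis_open[OF B(2)] by auto
      then show "X \<in> sets borel" using F by (auto intro!: borel_open open_Inter)
    qed
    then show "sigma_sets UNIV E \<subseteq> sets borel"
      using sets.sigma_sets_subset[of E borel] by simp
  qed
  ultimately show thesis using that by blast
qed

lemma conditional_distribution_unique:
  fixes Z :: "'a \<Rightarrow> 'c::second_countable_topology"
  assumes 1: "conditional_distribution M X Z Q" and 2: "conditional_distribution M X Z Q'"
  shows "AE x in distr M borel X. Q x = Q' x"
proof -
  let ?L = "distr M borel X"
  interpret sigma_finite_measure ?L
    using 1 by (simp add: conditional_distribution_def)
  have Q: "Q \<in> borel \<rightarrow>\<^sub>M prob_algebra borel" "Q' \<in> borel \<rightarrow>\<^sub>M prob_algebra borel"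
    using 1 2 by (auto simp: conditional_distribution_def)
  note [measurable] = Q[THEN measurable_prob_algebraD]
  obtain E :: "'c set set" where E: "countable E" "Int_stable E" "UNIV \<in> E" "sets borel = sigma_sets UNIV E"
    by (rule countable_Int_stable_generator_borel)
  have "AE x in ?L. emeasure (Q x) B = emeasure (Q' x) B" if "B \<in> E" for B
  proof (rule density_unique2)
    have [measurable]: "B \<in> sets borel" using that E(4) by auto
    show "(\<lambda>x. emeasure (Q x) B) \<in> borel_measurable ?L" "(\<lambda>x. emeasure (Q' x) B) \<in> borel_measurable ?L"
      by measurable
    show "(\<integral>\<^sup>+ x \<in> A. emeasure (Q x) B \<partial>?L) = (\<integral>\<^sup>+ x \<in> A. emeasure (Q' x) B \<partial>?L)" if "A \<in> sets ?L" for A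
      using 1 2 that by (simp add: conditional_distribution_def)
  qed
  then have "AE x in ?L. \<forall>B\<in>E. emeasure (Q x) B = emeasure (Q' x) B"
    using E(1) by (simp add: AE_ball_countable)
  then show ?thesis
  proof eventually_elim
    case (elim x)
    have s: "sets (Q x) = sets borel" "sets (Q' x) = sets borel" "prob_space (Q x)"
      using Q[THEN measurable_space, of x] by (auto simp: space_prob_algebra)
    show ?case
    proof (rule measure_eqI_generator_eq[OF E(2), where A="\<lambda>_. UNIV"])
      show "sets (Q x) = sigma_sets UNIV E" "sets (Q' x) = sigma_sets UNIV E" using s E(4) by auto
      show "emeasure (Q x) UNIV \<noteq> \<infinity>"
        using prob_space.emeasure_space_1[OF s(3)] sets_eq_imp_space_eq[OF s(1)] by simp
    qed (use E(3) elim in auto)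
  qed
qed

section \<open>Integrating out a flat prior\<close>

lemma left_part_append_vec [simp]: "left_part (append_vec u v) = u"
  and right_part_append_vec [simp]: "right_part (append_vec u v) = v"
  by (simp_all add: left_part_def right_part_def append_vec_def)

lemma append_vec_add: "append_vec u v + append_vec u' v' = append_vec (u + u') (v + v')"
  by (auto simp: append_vec_def vec_eq_iff split: sum.split)

lemma borel_measurable_left_part [measurable]: "left_part \<in> borel_measurable borel"
  and borel_measurable_right_part [measurable]: "right_part \<in> borel_measurable borel"
  by (auto intro!: borel_measurable_linear linearI simp: left_part_def right_part_def vec_eq_iff)

lemma borel_measurable_append_vec [measurable]:
  "(\<lambda>(u, v). append_vec u v) \<in> borel_measurable (borel \<Otimes>\<^sub>M borel)"
  unfolding borel_prod
  by (auto intro!: borel_measurable_linear linearI simp: append_vec_def vec_eq_iff split: sum.split)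

text \<open>
  Prediction in a linear model with a flat prior, for an arbitrary left inverse \<open>G\<close> of the design
  matrix.  \<open>E z\<close> is the part of the noise that cannot be absorbed into the regression
  coefficients; \<open>B\<close> is a regression matrix of the remaining noise of the second component
  on it, in the sense that the residual \<open>D z\<close> is uncorrelated with \<open>E z\<close>.
\<close>
lemma conditional_distribution_flat_prior:
  fixes H :: "real ^ 'p ^ 'n" and H00 :: "real ^ 'p ^ 'm"
    and U :: "real ^ 'k ^ 'n" and V :: "real ^ 'k ^ 'm"
    and G :: "real ^ 'n ^ 'p" and B :: "real ^ 'n ^ 'm"
    and K :: "real ^ 'p \<Rightarrow> (real ^ ('n + 'm)) measure"
  defines "E \<equiv> U - H ** G ** U"
  defines "D \<equiv> V - H00 ** G ** U - B ** E"
  assumes GH: "G ** H = mat 1"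
    and DE: "D ** transpose E = 0"
    and K: "\<And>\<beta>. K \<beta> = distr std_normal_vec borel (\<lambda>z. append_vec (H *v \<beta> + U *v z) (H00 *v \<beta> + V *v z))"
  shows "conditional_distribution (flat_prior_joint K) left_part right_part
    (\<lambda>y. distr std_normal_vec borel (\<lambda>z. (H00 ** G + B ** (mat 1 - H ** G)) *v y + D *v z))"
    (is "conditional_distribution ?M _ _ ?Q")
proof -
  let ?N = "std_gaussian :: (real ^ 'k) measure"
  let ?L = "distr ?M borel left_part"
  interpret N: prob_space ?N by (rule prob_space_std_gaussian)
  interpret pair_sigma_finite ?N "lborel :: (real ^ 'p) measure" ..
  have N_space: "(\<lambda>_. ?N) \<in> M \<rightarrow>\<^sub>M prob_algebra borel" for M :: "'z measure"
    by (rule measurable_const) (simp add: space_prob_algebra N.prob_space_axioms)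
  note K' = K[unfolded std_normal_vec_eq_std_gaussian]
  have Q: "?Q \<in> borel \<rightarrow>\<^sub>M prob_algebra borel"
    unfolding std_normal_vec_eq_std_gaussian
    by (rule measurable_distr_prob_space2[OF N_space]) measurable
  have Km: "K \<in> lborel \<rightarrow>\<^sub>M subprob_algebra borel"
    unfolding K'[abs_def]
    by (intro measurable_prob_algebraD measurable_distr_prob_space2[OF N_space]) measurable
  have setsM [simp, measurable_cong]: "sets ?M = sets borel"
    unfolding flat_prior_joint_def by (rule sets_bind[OF sets_kernel[OF Km]]) auto
  then have spaceM [simp]: "space ?M = UNIV" using sets_eq_imp_space_eq by fastforce
  have GE: "G *v (E *v z) = 0" for z
  proof -
    have "G ** E = 0"
      by (simp add: E_def matrix_diff_ldistrib matrix_mul_assoc GH)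
    then show ?thesis by (simp add: matrix_vector_mul_assoc)
  qed
  have GH': "G *v (H *v \<beta>) = \<beta>" for \<beta>
    by (simp add: matrix_vector_mul_assoc GH)
  have mean: "(H00 ** G + B ** (mat 1 - H ** G)) *v (H *v \<beta> + E *v z) = H00 *v \<beta> + B *v (E *v z)" for \<beta> z
    by (simp add: matrix_vector_mult_add_rdistrib matrix_vector_mult_diff_rdistrib
        matrix_vector_right_distrib matrix_vector_mult_diff_distrib matrix_vector_mul_assoc[symmetric] GE GH')
  have indep: "(\<integral>\<^sup>+z. h (E *v z) (D *v z) \<partial>?N) = (\<integral>\<^sup>+z. \<integral>\<^sup>+z'. h (E *v z) (D *v z') \<partial>?N \<partial>?N)"
    if [measurable]: "(\<lambda>(u, v). h u v) \<in> borel_measurable (borel \<Otimes>\<^sub>M borel)"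
    for h :: "real ^ 'n \<Rightarrow> real ^ 'm \<Rightarrow> ennreal"
  proof -
    have [measurable]: "(\<lambda>(u, v). h u v) \<in> borel_measurable borel"
      using that by (simp add: borel_prod)
    have "E ** transpose D = 0"
      using arg_cong[OF DE, of transpose] by (simp add: matrix_transpose_mul transpose_linear)
    then have *: "distr ?N borel (\<lambda>z. (E *v z, D *v z))
        = distr (?N \<Otimes>\<^sub>M ?N) borel (\<lambda>(z, z'). (E *v z, D *v z'))"
      by (intro std_gaussian_independent) (simp_all only: adjoint_matrix inner_transpose_mult
        matrix_vector_mul_linear matrix_vector_mult_0 inner_zero_right)
    have "(\<integral>\<^sup>+z. h (E *v z) (D *v z) \<partial>?N) = (\<integral>\<^sup>+(u, v). h u v \<partial>distr ?N borel (\<lambda>z. (E *v z, D *v z)))"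
      by (subst nn_integral_distr) (auto simp: borel_prod[symmetric])
    also have "\<dots> = (\<integral>\<^sup>+(z, z'). h (E *v z) (D *v z') \<partial>(?N \<Otimes>\<^sub>M ?N))"
      unfolding * by (subst nn_integral_distr) (auto simp: borel_prod[symmetric] split_beta')
    also have "\<dots> = (\<integral>\<^sup>+z. \<integral>\<^sup>+z'. h (E *v z) (D *v z') \<partial>?N \<partial>?N)"
      by (subst N.nn_integral_fst[symmetric]) auto
    finally show ?thesis .
  qed
  \<comment> \<open>For fixed \<open>z\<close>, translating \<open>\<beta>\<close> by \<open>- G U z\<close> replaces \<open>U z\<close> by \<open>E z\<close>; then \<open>E z\<close> and \<open>D z\<close> are decoupled.\<close>
  have joint: "(\<integral>\<^sup>+\<omega>. h (left_part \<omega>) (right_part \<omega>) \<partial>?M)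
      = (\<integral>\<^sup>+\<beta>. \<integral>\<^sup>+z. \<integral>\<^sup>+y0. h (H *v \<beta> + E *v z) y0 \<partial>?Q (H *v \<beta> + E *v z) \<partial>?N \<partial>lborel)"
    if [measurable]: "(\<lambda>(u, v). h u v) \<in> borel_measurable (borel \<Otimes>\<^sub>M borel)"
    for h :: "real ^ 'n \<Rightarrow> real ^ 'm \<Rightarrow> ennreal"
  proof -
    have "(\<integral>\<^sup>+\<omega>. h (left_part \<omega>) (right_part \<omega>) \<partial>?M)
        = (\<integral>\<^sup>+\<beta>. \<integral>\<^sup>+z. h (H *v \<beta> + U *v z) (H00 *v \<beta> + V *v z) \<partial>?N \<partial>lborel)"
      unfolding flat_prior_joint_def
      by (subst nn_integral_bind[OF _ Km]) (auto simp: K' nn_integral_distr)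
    also have "\<dots> = (\<integral>\<^sup>+z. \<integral>\<^sup>+\<beta>. h (H *v \<beta> + U *v z) (H00 *v \<beta> + V *v z) \<partial>lborel \<partial>?N)"
      by (rule Fubini') auto
    also have "\<dots> = (\<integral>\<^sup>+z. \<integral>\<^sup>+\<beta>. h (H *v (- (G *v (U *v z)) + \<beta>) + U *v z) (H00 *v (- (G *v (U *v z)) + \<beta>) + V *v z) \<partial>lborel \<partial>?N)"
      by (intro nn_integral_cong nn_integral_lborel_translate[symmetric,
            where h="\<lambda>\<beta>. h (H *v \<beta> + U *v z) (H00 *v \<beta> + V *v z)" for z]) auto
    also have "\<dots> = (\<integral>\<^sup>+z. \<integral>\<^sup>+\<beta>. h (H *v \<beta> + E *v z) (H00 *v \<beta> + B *v (E *v z) + D *v z) \<partial>lborel \<partial>?N)"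
      by (simp add: D_def E_def matrix_vector_mult_diff_rdistrib matrix_vector_mult_diff_distrib
            matrix_vector_right_distrib matrix_vector_mul_assoc[symmetric] algebra_simps)
    also have "\<dots> = (\<integral>\<^sup>+\<beta>. \<integral>\<^sup>+z. h (H *v \<beta> + E *v z) (H00 *v \<beta> + B *v (E *v z) + D *v z) \<partial>?N \<partial>lborel)"
      by (rule Fubini'[symmetric]) auto
    also have "\<dots> = (\<integral>\<^sup>+\<beta>. \<integral>\<^sup>+z. \<integral>\<^sup>+z'. h (H *v \<beta> + E *v z) (H00 *v \<beta> + B *v (E *v z) + D *v z') \<partial>?N \<partial>?N \<partial>lborel)"
      by (intro nn_integral_cong indep) auto
    also have "\<dots> = (\<integral>\<^sup>+\<beta>. \<integral>\<^sup>+z. \<integral>\<^sup>+y0. h (H *v \<beta> + E *v z) y0 \<partial>?Q (H *v \<beta> + E *v z) \<partial>?N \<partial>lborel)"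
      unfolding std_normal_vec_eq_std_gaussian mean
      by (intro nn_integral_cong, subst nn_integral_distr) auto
    finally show ?thesis .
  qed
  have Qone: "emeasure (?Q y) UNIV = 1" for y
    using measurable_space[OF Q, of y] prob_space.emeasure_space_1[of "?Q y"]
    by (simp add: space_prob_algebra)
  have marginal: "(\<integral>\<^sup>+y. h y \<partial>?L) = (\<integral>\<^sup>+\<beta>. \<integral>\<^sup>+z. h (H *v \<beta> + E *v z) \<partial>?N \<partial>lborel)"
    if [measurable]: "h \<in> borel_measurable borel" for h :: "real ^ 'n \<Rightarrow> ennreal"
    using joint[of "\<lambda>u v. h u"] by (simp add: nn_integral_distr Qone)
  have "sigma_finite_measure ?L"
  proof
    \<comment> \<open>On these slabs \<open>G y = \<beta>\<close> is bounded, so their mass is the volume of a ball.\<close>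
    let ?S = "\<lambda>k::nat. {y. norm (G *v y) \<le> real k}"
    have S [measurable]: "?S k \<in> sets borel" for k by measurable
    have "emeasure ?L (?S k) = (\<integral>\<^sup>+\<beta>. \<integral>\<^sup>+z. indicator (cball (0 :: real ^ 'p) (real k)) \<beta> \<partial>?N \<partial>lborel)" for k
    proof -
      have "emeasure ?L (?S k) = (\<integral>\<^sup>+y. indicator (?S k) y \<partial>?L)"
        by (rule nn_integral_indicator[symmetric]) simp
      also have "\<dots> = (\<integral>\<^sup>+\<beta>. \<integral>\<^sup>+z. indicator (?S k) (H *v \<beta> + E *v z) \<partial>?N \<partial>lborel)"
        by (rule marginal) measurable
      finally show ?thesis
        by (simp add: matrix_vector_right_distrib GE GH' indicator_def)
    qed
    then have fin: "emeasure ?L (?S k) < \<infinity>" for k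
      using emeasure_lborel_cball_finite[of "0 :: real ^ 'p" "real k"] by (simp add: N.emeasure_space_1[simplified])
    show "\<exists>A. countable A \<and> A \<subseteq> sets ?L \<and> \<Union>A = space ?L \<and> (\<forall>a\<in>A. emeasure ?L a \<noteq> \<infinity>)"
    proof (intro exI[of _ "range ?S"] conjI)
      show "\<Union>(range ?S) = space ?L" using real_nat_ceiling_ge by auto
    qed (use fin in \<open>auto simp: less_top[symmetric]\<close>)
  qed
  moreover have "emeasure ?M {\<omega> \<in> space ?M. left_part \<omega> \<in> A \<and> right_part \<omega> \<in> C}
      = (\<integral>\<^sup>+ y\<in>A. emeasure (?Q y) C \<partial>?L)" if [measurable]: "A \<in> sets borel" "C \<in> sets borel" for A C
  proof -
    note [measurable] = measurable_prob_algebraD[OF Q]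
    have "emeasure ?M {\<omega> \<in> space ?M. left_part \<omega> \<in> A \<and> right_part \<omega> \<in> C}
        = (\<integral>\<^sup>+\<omega>. indicator {\<omega> \<in> space ?M. left_part \<omega> \<in> A \<and> right_part \<omega> \<in> C} \<omega> \<partial>?M)"
      by (rule nn_integral_indicator[symmetric]) measurable
    also have "\<dots> = (\<integral>\<^sup>+\<omega>. indicator A (left_part \<omega>) * indicator C (right_part \<omega>) \<partial>?M)"
      by (intro nn_integral_cong) (auto simp: indicator_def)
    also have "\<dots> = (\<integral>\<^sup>+\<beta>. \<integral>\<^sup>+z. emeasure (?Q (H *v \<beta> + E *v z)) C * indicator A (H *v \<beta> + E *v z) \<partial>?N \<partial>lborel)"
      by (subst joint) (auto intro!: nn_integral_cong simp: nn_integral_cmult mult.commute[of "emeasure _ C"])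
    also have "\<dots> = (\<integral>\<^sup>+ y\<in>A. emeasure (?Q y) C \<partial>?L)"
      by (rule marginal[symmetric]) auto
    finally show ?thesis .
  qed
  ultimately show ?thesis
    using Q by (simp add: conditional_distribution_def)
qed

section \<open>The prediction formulas\<close>

text \<open>
  \<open>P P\<^sup>T\<close> and \<open>W W\<^sup>T\<close> add up to the identity while the columns of \<open>P\<close> and \<open>W\<close> are mutually orthogonal, so the
  two matrices are the complementary orthogonal projections.
\<close>
lemma orthonormal_splitting:
  fixes H P :: "real ^ 'p ^ 'n" and W :: "real ^ 'q ^ 'n"
  assumes rank: "rank H = CARD('p)" "rank W = CARD('q)"
    and span: "span (columns P) = span (columns H)" "span (columns W) = orthogonal_comp (span (columns H))"
    and I: "P ** transpose P + W ** transpose W = mat 1"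
  shows "transpose W ** W = mat 1" "P ** transpose P ** H = H"
    "invertible (transpose P ** H)"
proof -
  have W0: "transpose W ** X = 0" if X: "span (columns X) = span (columns H)" for X :: "real ^ 'p ^ 'n"
  proof -
    have "orthogonal (column i W) (column j X)" for i j
    proof -
      have "column j X \<in> span (columns H)"
        unfolding X[symmetric] by (rule span_base) (auto simp: columns_def)
      moreover have "column i W \<in> orthogonal_comp (span (columns H))"
        unfolding span(2)[symmetric] by (rule span_base) (auto simp: columns_def)
      ultimately show ?thesis by (auto simp: orthogonal_comp_def orthogonal_commute)
    qed
    then show ?thesis
      by (simp add: vec_eq_iff matrix_matrix_mult_def transpose_def orthogonal_def column_def inner_vec_def)
  qed
  have WP: "transpose W ** P = 0" and WH: "transpose W ** H = 0"
    using W0 span(1) by auto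
  have split: "P ** (transpose P ** X) + W ** (transpose W ** X) = X" for X :: "real ^ 'j ^ 'n"
    using arg_cong[OF I, of "\<lambda>M. M ** X"] by (simp add: matrix_add_rdistrib matrix_mul_assoc)
  have "transpose P ** W = 0"
    using arg_cong[OF WP, of transpose] by (simp add: matrix_transpose_mul transpose_linear)
  moreover obtain LW :: "real ^ 'n ^ 'q" where LW: "LW ** W = mat 1"
    using rank(2) full_rank_injective matrix_left_invertible_injective by metis
  ultimately show "transpose W ** W = mat 1"
    using split[of W] LW by (metis add_0 matrix_mul_assoc matrix_mul_lid matrix_mult_zero(1))
  show PPH: "P ** transpose P ** H = H"
    using split[of H] WH by (simp add: matrix_mult_zero matrix_mul_assoc)
  obtain L :: "real ^ 'n ^ 'p" where L: "L ** H = mat 1"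
    using rank(1) full_rank_injective matrix_left_invertible_injective by metis
  have "(L ** P) ** (transpose P ** H) = mat 1"
    using L PPH by (metis matrix_mul_assoc)
  then show "invertible (transpose P ** H)"
    using invertible_left_inverse by blast
qed

text \<open>
  A compression of an invertible matrix may be singular.  Here a multiple of \<open>Sig\<close> is \<open>U U\<^sup>T\<close>, so the
  form \<open>x \<bullet> (W\<^sup>T Sig W) x\<close> vanishes only if \<open>U\<^sup>T W x = 0\<close>, hence only if \<open>Sig W x = 0\<close>.
\<close>
lemma invertible_compression:
  fixes Sig :: "real ^ 'n ^ 'n" and U :: "real ^ 'k ^ 'n" and W :: "real ^ 'q ^ 'n"
  assumes "c \<noteq> 0" "c *\<^sub>R Sig = U ** transpose U" "invertible Sig" "transpose W ** W = mat 1"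
  shows "invertible (transpose W ** Sig ** W)"
  unfolding invertible_left_inverse matrix_left_invertible_ker
proof (intro allI impI)
  fix x assume "(transpose W ** Sig ** W) *v x = 0"
  then have "0 = x \<bullet> (c *\<^sub>R ((transpose W ** Sig ** W) *v x))" by simp
  also have "\<dots> = x \<bullet> (transpose W *v ((c *\<^sub>R Sig) *v (W *v x)))"
    by (simp only: matrix_vector_mul_assoc[symmetric] scaleR_matrix_vector_assoc[symmetric]
        matrix_vector_mult_scaleR)
  also have "\<dots> = (W *v x) \<bullet> ((U ** transpose U) *v (W *v x))"
    by (simp only: assms(2) dot_lmul_matrix[symmetric] vector_transpose_matrix)
  also have "\<dots> = (transpose U *v (W *v x)) \<bullet> (transpose U *v (W *v x))"
    by (rule inner_transpose_mult[symmetric])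
  finally have "transpose U *v (W *v x) = 0" by simp
  then have "(c *\<^sub>R Sig) *v (W *v x) = 0"
    by (metis assms(2) matrix_vector_mul_assoc matrix_vector_mult_0_right)
  then have "Sig *v (W *v x) = 0"
    using assms(1) by (simp add: scaleR_matrix_vector_assoc[symmetric])
  then have "W *v x = 0"
    using assms(3) by (metis invertible_left_inverse matrix_left_invertible_ker)
  then show "x = 0"
    using assms(4) by (metis matrix_left_invertible_ker)
qed

text \<open>
  Everything rests on \<open>H G = P P\<^sup>T\<close>, which gives \<open>E = W W\<^sup>T U\<close>.  Then \<open>E E\<^sup>T = s W T W\<^sup>T\<close>, and the
  covariance of \<open>D\<^sub>0 = V - H\<^sub>0\<^sub>0 G U\<close> with \<open>E\<close> is \<open>- s S\<^sub>0\<^sub>W W\<^sup>T\<close>, so the stated \<open>B\<close> solves the normal equations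
  \<open>B E E\<^sup>T = D\<^sub>0 E\<^sup>T\<close>.  The variance formula is \<open>D D\<^sup>T = D D\<^sub>0\<^sup>T = D\<^sub>0 D\<^sub>0\<^sup>T - B E D\<^sub>0\<^sup>T\<close>.
\<close>
lemma flat_prior_kriging_algebra:
  fixes H P :: "real ^ 'p ^ 'n" and H00 :: "real ^ 'p ^ 'm" and W :: "real ^ 'q ^ 'n"
    and U :: "real ^ 'k ^ 'n" and V :: "real ^ 'k ^ 'm"
    and Sig :: "real ^ 'n ^ 'n" and Sig0 :: "real ^ 'n ^ 'm"
  defines "T \<equiv> transpose W ** Sig ** W"
  defines "G \<equiv> matrix_inv (transpose P ** H) ** transpose P"
  defines "E \<equiv> U - H ** G ** U"
  defines "B \<equiv> - (S_0W H H00 P W Sig Sig0 ** matrix_inv T ** transpose W)"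
  defines "D \<equiv> V - H00 ** G ** U - B ** E"
  assumes PW: "transpose W ** W = mat 1" "P ** transpose P ** H = H"
      "P ** transpose P + W ** transpose W = mat 1"
    and inv: "invertible (transpose P ** H)" "invertible T"
    and cov: "U ** transpose U = s *\<^sub>R Sig" "V ** transpose U = s *\<^sub>R Sig0" "V ** transpose V = s *\<^sub>R Sig00"
  shows "G ** H = mat 1" "D ** transpose E = 0"
    "pred_mean H H00 P W Sig Sig0 y = (H00 ** G + B ** (mat 1 - H ** G)) *v y"
    "pred_cov s H H00 P W Sig Sig0 Sig00 = D ** transpose D"
proof -
  let ?S = "S_0W H H00 P W Sig Sig0"
  define D0 where "D0 = V - H00 ** G ** U"
  show GH: "G ** H = mat 1"
    using matrix_inv_inverse(2)[OF inv(1)] by (simp add: G_def matrix_mul_assoc[symmetric])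
  have HG: "H ** G = P ** transpose P"
  proof -
    have "H ** G = P ** (transpose P ** H ** matrix_inv (transpose P ** H)) ** transpose P"
      by (subst PW(2)[symmetric]) (simp add: G_def matrix_mul_assoc)
    then show ?thesis by (simp add: matrix_inv_inverse(1)[OF inv(1)])
  qed
  have HG': "mat 1 - H ** G = W ** transpose W"
    using PW(3) by (simp add: HG algebra_simps)
  have E: "E = W ** transpose W ** U"
    by (simp add: E_def HG'[symmetric] matrix_diff_rdistrib)
  have H0: "H0 ** transpose P = H00 ** G" if "H0 = H_0dot H H00 P" for H0
    by (simp add: that H_0dot_def G_def matrix_mul_assoc)
  have UV: "U ** transpose V = s *\<^sub>R transpose Sig0"
    using arg_cong[OF cov(2), of transpose] by (simp add: matrix_transpose_mul transpose_linear)
  have S: "?S = (H00 ** G ** Sig - Sig0) ** W"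
    by (simp add: S_0W_def H0)
  have BW: "B ** W = - (?S ** matrix_inv T)"
    by (simp add: B_def matrix_mult_minus matrix_mul_assoc[symmetric] PW)
  have DU: "D0 ** transpose U = - (s *\<^sub>R (H00 ** G ** Sig - Sig0))"
    by (simp add: D0_def matrix_diff_rdistrib cov matrix_mul_assoc[symmetric] matrix_mult_scaleR scaleR_diff_right)
  have tE: "transpose E = transpose U ** W ** transpose W"
    by (simp add: E matrix_transpose_mul matrix_mul_assoc)
  have D0E: "D0 ** transpose E = - (s *\<^sub>R (?S ** transpose W))"
    by (simp add: tE matrix_mul_assoc DU matrix_mult_minus S matrix_mult_scaleR)
  have EE: "E ** transpose E = s *\<^sub>R (W ** T ** transpose W)"
  proof -
    have "E ** transpose E = W ** transpose W ** (U ** transpose U) ** W ** transpose W"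
      by (subst tE) (simp add: E matrix_mul_assoc)
    then show ?thesis
      by (simp add: cov T_def matrix_mul_assoc matrix_mult_scaleR)
  qed
  have BEE: "B ** E ** transpose E = - (s *\<^sub>R (?S ** transpose W))"
  proof -
    have "B ** E ** transpose E = s *\<^sub>R ((B ** W) ** T ** transpose W)"
      by (simp add: EE matrix_mul_assoc[symmetric] matrix_mult_scaleR)
    also have "\<dots> = - (s *\<^sub>R (?S ** (matrix_inv T ** T) ** transpose W))"
      by (simp add: BW matrix_mult_minus matrix_mul_assoc)
    finally show ?thesis by (simp add: matrix_inv_inverse(2)[OF inv(2)])
  qed
  have D: "D = D0 - B ** E" by (simp add: D_def D0_def)
  show DE: "D ** transpose E = 0"
    by (simp add: D matrix_diff_rdistrib D0E BEE)
  show "pred_mean H H00 P W Sig Sig0 y = (H00 ** G + B ** (mat 1 - H ** G)) *v y"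
  proof -
    have "B ** (mat 1 - H ** G) = - (?S ** matrix_inv T ** transpose W)"
      by (simp add: HG' matrix_mul_assoc BW matrix_mult_minus)
    then show ?thesis
      by (simp add: pred_mean_def E_0_def H0 T_def[symmetric] matrix_vector_mult_diff_rdistrib)
  qed
  have D00: "D0 ** transpose D0 = s *\<^sub>R S_00 H H00 P Sig Sig0 Sig00"
  proof -
    have 1: "H00 ** G ** U ** transpose U = s *\<^sub>R (H00 ** G ** Sig)"
      "H00 ** G ** U ** transpose V = s *\<^sub>R (H00 ** G ** transpose Sig0)"
      by (simp_all add: matrix_mul_assoc[symmetric] cov UV matrix_mult_scaleR)
    have t: "transpose G ** transpose H00 = P ** transpose (H_0dot H H00 P)"
      using arg_cong[OF H0[OF refl], of transpose] by (simp add: matrix_transpose_mul)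
    have "D0 ** transpose D0 = (V - H00 ** G ** U) ** (transpose V - transpose U ** (P ** transpose (H_0dot H H00 P)))"
      by (simp add: D0_def transpose_linear matrix_transpose_mul t matrix_mul_assoc[symmetric])
    also have "\<dots> = s *\<^sub>R S_00 H H00 P Sig Sig0 Sig00"
      by (simp add: S_00_def H0 matrix_diff_rdistrib matrix_diff_ldistrib matrix_mul_assoc cov 1
          matrix_mult_scaleR scaleR_diff_right scaleR_add_right)
    finally show ?thesis .
  qed
  have ED0: "E ** transpose D0 = - (s *\<^sub>R (W ** transpose ?S))"
    using arg_cong[OF D0E, of transpose] by (simp add: matrix_transpose_mul transpose_linear)
  have "transpose D = transpose D0 - transpose E ** transpose B"
    by (simp add: D transpose_linear matrix_transpose_mul)
  then have "D ** transpose D = D ** transpose D0"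
    by (simp add: matrix_diff_ldistrib matrix_mul_assoc DE matrix_mult_zero)
  also have "\<dots> = D0 ** transpose D0 - B ** (E ** transpose D0)"
    by (simp add: D matrix_diff_rdistrib matrix_mul_assoc)
  also have "\<dots> = s *\<^sub>R S_00 H H00 P Sig Sig0 Sig00 + s *\<^sub>R ((B ** W) ** transpose ?S)"
    by (simp add: D00 ED0 matrix_mult_minus matrix_mult_scaleR matrix_mul_assoc)
  also have "\<dots> = pred_cov s H H00 P W Sig Sig0 Sig00"
    by (simp add: BW pred_cov_def T_def matrix_mult_minus scaleR_diff_right)
  finally show "pred_cov s H H00 P W Sig Sig0 Sig00 = D ** transpose D" ..
qed

lemma block_factor:
  fixes A :: "real ^ ('n::finite + 'm::finite) ^ ('n + 'm)"
  assumes "c *\<^sub>R block_matrix S1 S2 S3 S4 = A ** transpose A"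
  obtains U :: "real ^ ('n + 'm) ^ 'n" and V :: "real ^ ('n + 'm) ^ 'm"
  where "\<And>z. A *v z = append_vec (U *v z) (V *v z)"
    "U ** transpose U = c *\<^sub>R S1" "V ** transpose U = c *\<^sub>R S3" "V ** transpose V = c *\<^sub>R S4"
proof
  let ?U = "\<chi> i. A $ Inl i" and ?V = "\<chi> j. A $ Inr j"
  show "A *v z = append_vec (?U *v z) (?V *v z)" for z
    by (auto simp: vec_eq_iff append_vec_def matrix_vector_mult_def split: sum.split)
  have "(c *\<^sub>R block_matrix S1 S2 S3 S4) $ k $ l = (A ** transpose A) $ k $ l" for k l
    using assms by simp
  then have entry: "c * block_matrix S1 S2 S3 S4 $ k $ l = (\<Sum>i\<in>UNIV. A $ k $ i * A $ l $ i)" for k l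
    by (simp add: matrix_matrix_mult_def transpose_def)
  show "?U ** transpose ?U = c *\<^sub>R S1" "?V ** transpose ?U = c *\<^sub>R S3" "?V ** transpose ?V = c *\<^sub>R S4"
    using entry[of "Inl _" "Inl _"] entry[of "Inr _" "Inl _"] entry[of "Inr _" "Inr _"]
    by (simp_all add: vec_eq_iff matrix_matrix_mult_def transpose_def block_matrix_def append_vec_def)
qed

theorem corollary2:
  fixes H P :: "real ^ 'p ^ 'n"
    and H00 :: "real ^ 'p ^ 'm"
    and W :: "real ^ 'q ^ 'n"
    and Sig :: "real ^ 'n ^ 'n"
    and Sig0 :: "real ^ 'n ^ 'm"
    and Sig00 :: "real ^ 'm ^ 'm"
    and sigma2 :: real
    and K :: "real ^ 'p \<Rightarrow> (real ^ ('n + 'm)) measure"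
  assumes "CARD('p) < CARD('n)"
    and "CARD('q) = CARD('n) - CARD('p)"
    and "sigma2 > 0"
    and "invertible Sig"
    and "rank H = CARD('p)"
    and "rank P = CARD('p)" and "span (columns P) = span (columns H)"
    and "rank W = CARD('q)" and "span (columns W) = orthogonal_comp (span (columns H))"
    and model: "\<And>\<beta>. multivariate_normal (K \<beta>)
           (append_vec (H *v \<beta>) (H00 *v \<beta>))
           (sigma2 *\<^sub>R block_matrix Sig (transpose Sig0) Sig0 Sig00)"
    and "P ** transpose P + W ** transpose W = mat 1"
  shows "(\<exists>Q. conditional_distribution (flat_prior_joint K) left_part right_part Q \<and>
            (\<forall>y. multivariate_normal (Q y)
                   (pred_mean H H00 P W Sig Sig0 y)
                   (pred_cov sigma2 H H00 P W Sig Sig0 Sig00))) \<and>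
         (\<forall>Q. conditional_distribution (flat_prior_joint K) left_part right_part Q \<longrightarrow>
            (AE y in distr (flat_prior_joint K) borel left_part.
               multivariate_normal (Q y)
                 (pred_mean H H00 P W Sig Sig0 y)
                 (pred_cov sigma2 H H00 P W Sig Sig0 Sig00)))"
proof -
  obtain A :: "real ^ ('n + 'm) ^ ('n + 'm)"
    where A: "sigma2 *\<^sub>R block_matrix Sig (transpose Sig0) Sig0 Sig00 = A ** transpose A"
    using model[of 0] unfolding multivariate_normal_def by blast
  obtain U :: "real ^ ('n + 'm) ^ 'n" and V :: "real ^ ('n + 'm) ^ 'm"
    where UV: "\<And>z. A *v z = append_vec (U *v z) (V *v z)"
      "U ** transpose U = sigma2 *\<^sub>R Sig" "V ** transpose U = sigma2 *\<^sub>R Sig0"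
      "V ** transpose V = sigma2 *\<^sub>R Sig00"
    using block_factor[OF A] by blast
  have K: "K \<beta> = distr std_normal_vec borel (\<lambda>z. append_vec (H *v \<beta> + U *v z) (H00 *v \<beta> + V *v z))" for \<beta>
    using multivariate_normal_unique[OF model[of \<beta>, unfolded A]]
    by (simp add: UV append_vec_add)
  note PW = orthonormal_splitting[OF assms(5,8,7,9,11)]
  have T: "invertible (transpose W ** Sig ** W)"
    by (rule invertible_compression[of sigma2 _ U]) (use assms(3,4) UV PW in auto)
  note algebra = flat_prior_kriging_algebra[OF PW(1,2) assms(11) PW(3) T UV(2-4)]
  let ?G = "matrix_inv (transpose P ** H) ** transpose P"
  let ?B = "- (S_0W H H00 P W Sig Sig0 ** matrix_inv (transpose W ** Sig ** W) ** transpose W)"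
  let ?D = "V - H00 ** ?G ** U - ?B ** (U - H ** ?G ** U)"
  define Q where "Q = (\<lambda>y. distr std_normal_vec borel
    (\<lambda>z. (H00 ** ?G + ?B ** (mat 1 - H ** ?G)) *v y + ?D *v z))"
  have Q: "conditional_distribution (flat_prior_joint K) left_part right_part Q"
    unfolding Q_def by (rule conditional_distribution_flat_prior[OF algebra(1,2) K])
  have normal: "multivariate_normal (Q y) (pred_mean H H00 P W Sig Sig0 y)
      (pred_cov sigma2 H H00 P W Sig Sig0 Sig00)" for y
    unfolding Q_def algebra(3,4) by (rule multivariate_normal_distr)
  show ?thesis
  proof (intro conjI exI allI impI)
    fix Q' assume "conditional_distribution (flat_prior_joint K) left_part right_part Q'"
    from conditional_distribution_unique[OF this Q]
    show "AE y in distr (flat_prior_joint K) borel left_part.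
       multivariate_normal (Q' y) (pred_mean H H00 P W Sig Sig0 y)
         (pred_cov sigma2 H H00 P W Sig Sig0 Sig00)"
      by eventually_elim (simp add: normal)
  qed (rule Q, rule normal)
qed

end
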